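(* Let $X$ be a pseudocompact Tychonoff space containing an infinite discrete $C^*$-embedded subspace $D$. Then the function space $C_p(X)$ has an infinite-dimensional metrizable quotient. More precisely, for any sequence $(F_n)_{n=1}^\infty$ of non-empty, finite and pairwise disjoint subsets of $D$ with $\lim_{n\to\infty}|F_n|=\infty$ and the linear subspace $$Z=\bigcap_{n=1}^{\infty}\Big\{f\in C_p(X): \sum_{x\in F_n} f(x)=0\Big\},$$ the quotient space $C_p(X)/Z$ is isomorphic to the subspace $\ell_\infty=\{(x_n)\in\mathbb{R}^{\mathbb{N}}:\sup_n|x_n|<\infty\}$ of $\mathbb{R}^{\mathbb{N}}$.
   Context: For a Tychonoff space $X$, $C_p(X)$ is the space of continuous real-valued functions on $X$ with the topology of pointwise convergence. A Tychonoff space $X$ is pseudocompact if every continuous real-valued function on $X$ is bounded. A subspace $A$ of a topological space $X$ is $C^*$-embedded if each bounded continuous function $f:A\to\mathbb{R}$ has a continuous extension $\bar f:X\to\mathbb{R}$. $D$ is discrete in its subspace topology (it need not be closed in $X$). A quotient of a topological vector space $E$ is a space $E/Z$ with the quotient topology, where $Z$ is a closed linear subspace of $E$. "Isomorphic" means linearly homeomorphic. Here $\ell_\infty$ carries the topology inherited from the product topology of $\mathbb{R}^{\mathbb{N}}$ (not the norm topology). *)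

theory Defs
  imports "HOL-Analysis.Analysis"
begin

section \<open>Topological spaces\<close>

definition tychonoff_space :: "'a topology \<Rightarrow> bool" where
  "tychonoff_space X \<longleftrightarrow> completely_regular_space X \<and> Hausdorff_space X"

definition pseudocompact_space :: "'a topology \<Rightarrow> bool" where
  "pseudocompact_space X \<longleftrightarrow>
     tychonoff_space X \<and>
     (\<forall>f. continuous_map X euclideanreal f \<longrightarrow> bounded (f ` topspace X))"

definition Cstar_embedded :: "'a topology \<Rightarrow> 'a set \<Rightarrow> bool" where
  "Cstar_embedded X A \<longleftrightarrow>
     A \<subseteq> topspace X \<and>
     (\<forall>f. continuous_map (subtopology X A) euclideanreal f \<and> bounded (f ` A) \<longrightarrow>
        (\<exists>g. continuous_map X euclideanreal g \<and> (\<forall>x\<in>A. g x = f x)))"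


section \<open>Real topological vector spaces on a carrier set\<close>

text \<open>The carrier is the underlying set of the topology. The operations are only meaningful
  on the carrier. Type classes are not used because the spaces below, in particular the
  quotients, depend on parameters.\<close>

record 'v tvs =
  tvs_top :: "'v topology"
  tvs_add :: "'v \<Rightarrow> 'v \<Rightarrow> 'v"
  tvs_scale :: "real \<Rightarrow> 'v \<Rightarrow> 'v"
  tvs_zero :: 'v

abbreviation tvs_carrier :: "'v tvs \<Rightarrow> 'v set" where
  "tvs_carrier E \<equiv> topspace (tvs_top E)"

definition tvs_subspace :: "'v tvs \<Rightarrow> 'v set \<Rightarrow> bool" where
  "tvs_subspace E S \<longleftrightarrow>
     S \<subseteq> tvs_carrier E \<and> tvs_zero E \<in> S \<and>
     (\<forall>x\<in>S. \<forall>y\<in>S. tvs_add E x y \<in> S) \<and>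
     (\<forall>c. \<forall>x\<in>S. tvs_scale E c x \<in> S)"

definition tvs_closed_subspace :: "'v tvs \<Rightarrow> 'v set \<Rightarrow> bool" where
  "tvs_closed_subspace E S \<longleftrightarrow> tvs_subspace E S \<and> closedin (tvs_top E) S"

text \<open>The hull of \<open>B\<close> under \<^term>\<open>tvs_subspace E\<close> is the linear span of \<open>B\<close>.\<close>

definition tvs_infinite_dimensional :: "'v tvs \<Rightarrow> bool" where
  "tvs_infinite_dimensional E \<longleftrightarrow>
     \<not> (\<exists>B. finite B \<and> B \<subseteq> tvs_carrier E \<and> tvs_subspace E hull B = tvs_carrier E)"

definition tvs_isomorphic :: "'v tvs \<Rightarrow> 'w tvs \<Rightarrow> bool" where
  "tvs_isomorphic E F \<longleftrightarrow>
     (\<exists>T. homeomorphic_map (tvs_top E) (tvs_top F) T \<and>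
        (\<forall>x\<in>tvs_carrier E. \<forall>y\<in>tvs_carrier E. T (tvs_add E x y) = tvs_add F (T x) (T y)) \<and>
        (\<forall>c. \<forall>x\<in>tvs_carrier E. T (tvs_scale E c x) = tvs_scale F c (T x)))"


section \<open>Quotients\<close>

definition tvs_coset :: "'v tvs \<Rightarrow> 'v set \<Rightarrow> 'v \<Rightarrow> 'v set" where
  "tvs_coset E Z x = tvs_add E x ` Z"

definition quotient_topology :: "'v topology \<Rightarrow> ('v \<Rightarrow> 'w) \<Rightarrow> 'w topology" where
  "quotient_topology X q =
     topology (\<lambda>U. U \<subseteq> q ` topspace X \<and> openin X {x \<in> topspace X. q x \<in> U})"

text \<open>Adding \<open>Z\<close> in the scalar multiplication matters only for the scalar \<open>0\<close>, where
  \<open>0 A\<close> alone would be \<open>{0}\<close> instead of the coset \<open>Z\<close>.\<close>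

definition tvs_quotient :: "'v tvs \<Rightarrow> 'v set \<Rightarrow> 'v set tvs" where
  "tvs_quotient E Z =
     \<lparr> tvs_top = quotient_topology (tvs_top E) (tvs_coset E Z),
       tvs_add = (\<lambda>A B. {tvs_add E a b |a b. a \<in> A \<and> b \<in> B}),
       tvs_scale = (\<lambda>c A. {tvs_add E (tvs_scale E c a) z |a z. a \<in> A \<and> z \<in> Z}),
       tvs_zero = Z \<rparr>"

lemma openin_quotient_topology:
  "openin (quotient_topology X q) U \<longleftrightarrow>
     U \<subseteq> q ` topspace X \<and> openin X {x \<in> topspace X. q x \<in> U}"
proof -
  let ?P = "\<lambda>U. {x \<in> topspace X. q x \<in> U}"
  let ?O = "\<lambda>U. U \<subseteq> q ` topspace X \<and> openin X (?P U)"
  have "?O (S \<inter> T)" if "?O S" "?O T" for S T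
  proof -
    have "?P (S \<inter> T) = ?P S \<inter> ?P T"
      by blast
    then show ?thesis
      using that openin_Int[of X "?P S" "?P T"] by (simp add: le_infI1)
  qed
  moreover have "?O (\<Union>K)" if K: "\<And>U. U \<in> K \<Longrightarrow> ?O U" for K
  proof
    show "\<Union>K \<subseteq> q ` topspace X"
      using K by (meson Sup_least)
    have "openin X (\<Union> (?P ` K))"
      using K by (intro openin_Union) blast
    moreover have "\<Union> (?P ` K) = ?P (\<Union>K)"
      by blast
    ultimately show "openin X (?P (\<Union>K))"
      by argo
  qed
  ultimately have "istopology ?O"
    unfolding istopology_def by presburger
  then show ?thesis
    by (simp add: quotient_topology_def)
qed

lemma topspace_quotient_topology [simp]: "topspace (quotient_topology X q) = q ` topspace X"
proof
  show "topspace (quotient_topology X q) \<subseteq> q ` topspace X"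
    by (metis openin_quotient_topology openin_topspace)
  have "{x \<in> topspace X. q x \<in> q ` topspace X} = topspace X"
    by auto
  then have "openin (quotient_topology X q) (q ` topspace X)"
    by (simp add: openin_quotient_topology)
  then show "q ` topspace X \<subseteq> topspace (quotient_topology X q)"
    by (rule openin_subset)
qed

lemma quotient_map_quotient_topology: "quotient_map X (quotient_topology X q) q"
  by (auto simp: quotient_map_def openin_quotient_topology)


section \<open>Spaces of real-valued functions\<close>

text \<open>Real functions on \<open>I\<close> are represented as in \<^term>\<open>powertop_real I\<close>, that is, extensionally:
  they take the value \<^const>\<open>undefined\<close> outside \<open>I\<close>.\<close>

definition function_tvs :: "'a set \<Rightarrow> ('a \<Rightarrow> real) set \<Rightarrow> ('a \<Rightarrow> real) tvs" where
  "function_tvs I S =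
     \<lparr> tvs_top = subtopology (powertop_real I) S,
       tvs_add = (\<lambda>f g. \<lambda>i\<in>I. f i + g i),
       tvs_scale = (\<lambda>c f. \<lambda>i\<in>I. c * f i),
       tvs_zero = (\<lambda>i\<in>I. 0) \<rparr>"

definition Cp :: "'a topology \<Rightarrow> ('a \<Rightarrow> real) tvs" where
  "Cp X = function_tvs (topspace X) {f. continuous_map X euclideanreal f}"

definition linf_pointwise :: "(nat \<Rightarrow> real) tvs" where
  "linf_pointwise = function_tvs UNIV {x. bdd_above (range (\<lambda>n. \<bar>x n\<bar>))}"

lemma tvs_carrier_Cp:
  "tvs_carrier (Cp X) = {f \<in> extensional (topspace X). continuous_map X euclideanreal f}"
  by (auto simp: Cp_def function_tvs_def PiE_def)

lemma tvs_carrier_linf_pointwise: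
  "tvs_carrier linf_pointwise = {x. bdd_above (range (\<lambda>n. \<bar>x n\<bar>))}"
  by (auto simp: linf_pointwise_def function_tvs_def)

lemma tvs_subspace_Cp: "tvs_subspace (Cp X) (tvs_carrier (Cp X))"
  unfolding tvs_subspace_def tvs_carrier_Cp
  by (auto simp: Cp_def function_tvs_def restrict_continuous_map
      intro!: continuous_map_add continuous_map_real_mult)

lemma
  assumes Z: "tvs_subspace (Cp X) Z"
  shows tvs_quotient_Cp_add:
      "tvs_add (tvs_quotient (Cp X) Z) (tvs_coset (Cp X) Z f) (tvs_coset (Cp X) Z g) =
       tvs_coset (Cp X) Z (tvs_add (Cp X) f g)" (is ?add)
    and tvs_quotient_Cp_scale:
      "tvs_scale (tvs_quotient (Cp X) Z) c (tvs_coset (Cp X) Z f) =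
       tvs_coset (Cp X) Z (tvs_scale (Cp X) c f)" (is ?scale)
    and tvs_quotient_Cp_zero:
      "tvs_zero (tvs_quotient (Cp X) Z) = tvs_coset (Cp X) Z (tvs_zero (Cp X))" (is ?zero)
proof -
  define p where "p = tvs_add (Cp X)"
  define s where "s = tvs_scale (Cp X)"
  define o' where "o' = tvs_zero (Cp X)"
  note ops = p_def s_def o'_def Cp_def function_tvs_def
  have sub: "o' \<in> Z" "\<And>x y. x \<in> Z \<Longrightarrow> y \<in> Z \<Longrightarrow> p x y \<in> Z" "\<And>c x. x \<in> Z \<Longrightarrow> s c x \<in> Z"
    and ext: "\<And>x. x \<in> Z \<Longrightarrow> x \<in> extensional (topspace X)"
    using Z by (auto simp: tvs_subspace_def tvs_carrier_Cp p_def s_def o'_def)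
  have id: "p o' x = x" "p x o' = x" if "x \<in> Z" for x
    using ext[OF that] by (auto simp: ops fun_eq_iff extensional_def)
  have e1: "p (p x z) (p y w) = p (p x y) (p z w)" for x y z w
    by (auto simp: ops fun_eq_iff)
  have e2: "p (s c (p x z)) w = p (s c x) (p (s c z) w)" for x z w c
    by (auto simp: ops fun_eq_iff algebra_simps)
  have e3: "s c o' = o'" for c
    by (auto simp: ops fun_eq_iff)
  have "{p a b |a b. a \<in> p f ` Z \<and> b \<in> p g ` Z} = p (p f g) ` Z"
  proof (intro equalityI subsetI)
    fix h assume "h \<in> {p a b |a b. a \<in> p f ` Z \<and> b \<in> p g ` Z}"
    then obtain z w where "z \<in> Z" "w \<in> Z" "h = p (p f z) (p g w)"
      by blast
    then have "h = p (p f g) (p z w)" "p z w \<in> Z"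
      using e1[of f z g w] sub(2) by simp_all
    then show "h \<in> p (p f g) ` Z"
      by blast
  next
    fix h assume "h \<in> p (p f g) ` Z"
    then obtain z where z: "z \<in> Z" "h = p (p f g) z"
      by blast
    then have "h = p (p f z) (p g o')"
      using e1[of f z g o'] id(2)[OF z(1)] by metis
    then show "h \<in> {p a b |a b. a \<in> p f ` Z \<and> b \<in> p g ` Z}"
      using z sub(1) by blast
  qed
  then show ?add
    by (simp add: tvs_quotient_def tvs_coset_def p_def)
  have "{p (s c a) z |a z. a \<in> p f ` Z \<and> z \<in> Z} = p (s c f) ` Z"
  proof (intro equalityI subsetI)
    fix h assume "h \<in> {p (s c a) z |a z. a \<in> p f ` Z \<and> z \<in> Z}"
    then obtain z w where "z \<in> Z" "w \<in> Z" "h = p (s c (p f z)) w"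
      by blast
    then have "h = p (s c f) (p (s c z) w)" "p (s c z) w \<in> Z"
      using e2[of c f z w] sub(2,3) by simp_all
    then show "h \<in> p (s c f) ` Z"
      by blast
  next
    fix h assume "h \<in> p (s c f) ` Z"
    then obtain z where z: "z \<in> Z" "h = p (s c f) z"
      by blast
    then have "h = p (s c (p f o')) z"
      using e2[of c f o' z] e3[of c] id(1)[OF z(1)] by metis
    then show "h \<in> {p (s c a) z |a z. a \<in> p f ` Z \<and> z \<in> Z}"
      using z sub(1) by blast
  qed
  then show ?scale
    by (simp add: tvs_quotient_def tvs_coset_def p_def s_def)
  have "p o' ` Z = Z"
    using id(1) by force
  then show ?zero
    by (simp add: tvs_quotient_def tvs_coset_def p_def o'_def)
qed

end

theory Submission
  imports Defs "HOL-Library.Function_Algebras"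
begin

text \<open>The map sending \<open>f\<close> to its sequence of averages over the sets \<open>F n\<close> is linear, continuous and, since
  \<open>D\<close> is discrete and \<open>C\<^sup>*\<close>-embedded, maps onto the bounded sequences; its kernel is \<open>Z\<close>. So it
  suffices that it is open. This reduces to solving, for a finite set \<open>K\<close> and bounded \<open>y\<close> supported on
  large indices, the equation with an \<open>f\<close> that vanishes on \<open>K\<close>. Split each large \<open>F n\<close> into
  \<open>card K + 1\<close> equal parts, up to a remainder. Disjoint subsets of \<open>D\<close> have disjoint closures, so for
  some \<open>j\<close> the closure of the union of the \<open>j\<close>-th parts misses \<open>K\<close>. Concentrating \<open>y n\<close> on
  the \<open>j\<close>-th part of \<open>F n\<close> costs only a bounded factor, and a function separating that closure
  from \<open>K\<close> makes the solution vanish on \<open>K\<close>.\<close>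

section \<open>Finite averages on a discrete \<open>C\<^sup>*\<close>-embedded set\<close>

text \<open>On a discrete set every function is continuous, so \<open>C^*\<close>-embedding extends
  arbitrary bounded functions. All functions built below arise this way.\<close>

lemma Cstar_embedded_discrete_extension:
  assumes "Cstar_embedded X D" "subtopology X D = discrete_topology D" "bounded (f ` D)"
  obtains g where "continuous_map X euclideanreal g" "\<And>x. x \<in> D \<Longrightarrow> g x = f x"
  using assms by (auto simp: Cstar_embedded_def)

text \<open>A continuous extension of the indicator of \<open>S\<close> is 1 on the closure of
  \<open>S\<close> and 0 on that of \<open>T\<close>. Since \<open>D\<close> need not be closed,
  these closures may contain points outside \<open>D\<close>.\<close>

lemma Cstar_embedded_discrete_disjoint_closures:
  assumes "Cstar_embedded X D" "subtopology X D = discrete_topology D"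
    and "S \<subseteq> D" "T \<subseteq> D" "S \<inter> T = {}"
  shows "X closure_of S \<inter> X closure_of T = {}"
proof -
  have "bounded ((\<lambda>x. indicator S x :: real) ` D)"
    by (rule boundedI[where B = 1]) (auto simp: indicator_def)
  then obtain g where g: "continuous_map X euclideanreal g" "\<And>x. x \<in> D \<Longrightarrow> g x = indicator S x"
    using Cstar_embedded_discrete_extension[OF assms(1,2)] by metis
  have "g x = 1" if "x \<in> X closure_of S" for x
  proof -
    have "g ` (X closure_of S) \<subseteq> euclideanreal closure_of (g ` S)"
      by (rule continuous_map_image_closure_subset[OF g(1)])
    also have "\<dots> \<subseteq> euclideanreal closure_of {1}"
      using g(2) assms(3) by (intro closure_of_mono) auto
    finally show ?thesis
      using that by auto
  qed
  moreover have "g x = 0" if "x \<in> X closure_of T" for x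
  proof -
    have "g ` (X closure_of T) \<subseteq> euclideanreal closure_of (g ` T)"
      by (rule continuous_map_image_closure_subset[OF g(1)])
    also have "\<dots> \<subseteq> euclideanreal closure_of {0}"
      using g(2) assms(4,5) by (intro closure_of_mono) (force simp: indicator_def)
    finally show ?thesis
      using that by auto
  qed
  ultimately show ?thesis
    by fastforce
qed

text \<open>Multiply separating functions, one per point of \<open>K\<close>: each is 1 on
  \<open>S\<close>, and at a point of \<open>K\<close> its own factor vanishes.\<close>

lemma completely_regular_space_finite_closed_sep:
  assumes "completely_regular_space X" "finite K" "K \<subseteq> topspace X" "closedin X S" "K \<inter> S = {}"
  obtains h where "continuous_map X euclideanreal h" "\<And>x. x \<in> K \<Longrightarrow> h x = 0" "\<And>x. x \<in> S \<Longrightarrow> h x = 1"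
proof -
  have "\<forall>a\<in>K. \<exists>f. continuous_map X euclideanreal f \<and> f a = 0 \<and> f ` S \<subseteq> {1}"
    using assms unfolding completely_regular_space_alt by blast
  then obtain u where u: "\<And>a. a \<in> K \<Longrightarrow> continuous_map X euclideanreal (u a) \<and> u a a = 0 \<and> u a ` S \<subseteq> {1}"
    by metis
  show thesis
  proof
    show "continuous_map X euclideanreal (\<lambda>x. \<Prod>a\<in>K. u a x)"
      using u assms(2) by (intro continuous_map_prod) auto
    show "(\<Prod>a\<in>K. u a x) = 0" if "x \<in> K" for x
      using u that assms(2) by (auto intro!: prod_zero)
    show "(\<Prod>a\<in>K. u a x) = 1" if "x \<in> S" for x
      using u that by (intro prod.neutral) blast
  qed
qed

section \<open>Finite combinatorics: equal parts and the pigeonhole principle\<close>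

lemma disjoint_subsets_of_card:
  assumes "finite A" "N * r \<le> card A"
  obtains P :: "nat \<Rightarrow> 'a set" where "\<And>j. j < N \<Longrightarrow> P j \<subseteq> A \<and> card (P j) = r" "disjoint_family_on P {..<N}"
proof -
  obtain h where h: "bij_betw h {0..<card A} A"
    using ex_bij_betw_nat_finite[OF assms(1)] by blast
  \<comment> \<open>Consecutive blocks of length \<open>r\<close>, carried into \<open>A\<close> by
    the enumeration \<open>h\<close>.\<close>
  define B where "B j = {j * r..<j * r + r}" for j
  have sub: "B j \<subseteq> {0..<card A}" if "j < N" for j
  proof -
    have "Suc j * r \<le> N * r"
      using that by (intro mult_le_mono1) simp
    with assms(2) show ?thesis
      by (auto simp: B_def)
  qed
  have disj: "B i \<inter> B j = {}" if "i < j" for i j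
  proof -
    have "Suc i * r \<le> j * r"
      using that by (intro mult_le_mono1) simp
    then show ?thesis
      by (auto simp: B_def)
  qed
  have inj: "inj_on h {0..<card A}"
    using h by (simp add: bij_betw_def)
  show thesis
  proof
    show "h ` B j \<subseteq> A \<and> card (h ` B j) = r" if "j < N" for j
      using sub[OF that] h inj_on_subset[OF inj sub[OF that]]
      by (auto simp: bij_betw_def card_image B_def)
    show "disjoint_family_on (\<lambda>j. h ` B j) {..<N}"
      unfolding disjoint_family_on_def
    proof (intro ballI impI)
      fix i j assume ij: "i \<in> {..<N}" "j \<in> {..<N}" "i \<noteq> j"
      then have "h ` (B i \<inter> B j) = h ` B i \<inter> h ` B j"
        using sub by (intro inj_on_image_Int[OF inj]) auto
      then show "h ` B i \<inter> h ` B j = {}"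
        using disj[of i j] disj[of j i] ij(3) by (metis Int_commute image_empty nat_neq_iff)
    qed
  qed
qed

text \<open>Otherwise a point of \<open>K\<close> chosen in each \<open>C j\<close> would inject
  \<open>N\<close> indices into \<open>K\<close>.\<close>

lemma finite_misses_disjoint_family:
  assumes "finite K" "disjoint_family_on C {..<N}" "card K < N"
  obtains j where "j < N" "K \<inter> C j = {}"
proof (rule ccontr)
  assume "\<not> thesis"
  then have "\<forall>j\<in>{..<N}. \<exists>x. x \<in> K \<inter> C j"
    using that by blast
  then obtain x where x: "\<And>j. j < N \<Longrightarrow> x j \<in> K \<inter> C j"
    by (metis lessThan_iff)
  have "inj_on x {..<N}"
  proof (rule inj_onI, rule ccontr)
    fix i j assume "i \<in> {..<N}" "j \<in> {..<N}" "x i = x j" "i \<noteq> j"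
    then show False
      using x[of i] x[of j] assms(2) unfolding disjoint_family_on_def by (metis IntD2 IntI empty_iff lessThan_iff)
  qed
  then have "card {..<N} \<le> card K"
    using x assms(1) by (intro card_inj_on_le) auto
  with assms(3) show False
    by simp
qed

text \<open>Plain sums of a bounded function can grow with \<open>card (F n)\<close>. Dividing keeps
  them bounded and, for nonempty finite \<open>F n\<close>, does not change the kernel.\<close>

definition averages :: "(nat \<Rightarrow> 'a set) \<Rightarrow> ('a \<Rightarrow> real) \<Rightarrow> nat \<Rightarrow> real" where
  "averages F f n = (\<Sum>x\<in>F n. f x) / real (card (F n))"

lemma averages_add: "averages F (\<lambda>x. f x + g x) = (\<lambda>n. averages F f n + averages F g n)"
  by (auto simp: averages_def sum.distrib add_divide_distrib)

lemma averages_scale: "averages F (\<lambda>x. c * f x) = (\<lambda>n. c * averages F f n)"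
  by (auto simp: averages_def simp flip: sum_distrib_left)

lemma averages_sum:
  "finite I \<Longrightarrow> averages F (\<lambda>x. \<Sum>i\<in>I. f i x) n = (\<Sum>i\<in>I. averages F (f i) n)"
  by (simp add: averages_def sum_divide_distrib sum.swap[of _ "F n"])

lemma averages_cong: "(\<And>n x. x \<in> F n \<Longrightarrow> f x = g x) \<Longrightarrow> averages F f = averages F g"
  by (auto simp: averages_def fun_eq_iff intro!: arg_cong2[of _ _ _ _ "(/)"] sum.cong)

lemma averages_bounded:
  assumes "bounded (f ` A)" "\<And>n. F n \<subseteq> A"
  shows "bdd_above (range (\<lambda>n. \<bar>averages F f n\<bar>))"
proof -
  obtain B where B: "B > 0" "\<And>x. x \<in> A \<Longrightarrow> \<bar>f x\<bar> \<le> B"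
    using assms(1) by (auto simp: bounded_pos)
  have "\<bar>averages F f n\<bar> \<le> B" for n
  proof -
    have "\<bar>\<Sum>x\<in>F n. f x\<bar> \<le> (\<Sum>x\<in>F n. \<bar>f x\<bar>)"
      by (rule sum_abs)
    also have "\<dots> \<le> real (card (F n)) * B"
      using B(2) assms(2) by (intro sum_bounded_above) auto
    finally show ?thesis
      \<comment> \<open>If \<open>F n\<close> is empty or infinite, its cardinality is 0 and the
        quotient is 0 by convention.\<close>
      using B(1) by (cases "card (F n) = 0") (auto simp: averages_def field_simps)
  qed
  then show ?thesis
    by (auto simp: bdd_above_def)
qed

text \<open>The core of openness. The order of quantifiers matters: \<open>m\<close> depends on
  \<open>K\<close> but not on \<open>y\<close>, so conditions at the points of \<open>K\<close>
  restrict only finitely many coordinates.\<close>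

lemma averages_preimage_vanishing_on_finite:
  fixes F :: "nat \<Rightarrow> 'a set"
  assumes cr: "completely_regular_space X"
    and D: "Cstar_embedded X D" "subtopology X D = discrete_topology D"
    and F: "\<And>n. F n \<noteq> {} \<and> finite (F n) \<and> F n \<subseteq> D" "\<And>m n. m \<noteq> n \<Longrightarrow> F m \<inter> F n = {}"
    and lim: "filterlim (\<lambda>n. card (F n)) at_top sequentially"
    and K: "finite K" "K \<subseteq> topspace X"
  shows "\<exists>m. \<forall>y. bdd_above (range (\<lambda>n. \<bar>y n\<bar>)) \<and> (\<forall>n<m. y n = 0) \<longrightarrow>
           (\<exists>f. continuous_map X euclideanreal f \<and> (\<forall>x\<in>K. f x = 0) \<and> averages F f = y)"
proof -
  have DX: "D \<subseteq> topspace X"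
    using D(1) by (simp add: Cstar_embedded_def)
  \<comment> \<open>One part more than \<open>K\<close> has points, as the pigeonhole argument
    requires.\<close>
  define N where "N = Suc (card K)"
  define r where "r n = card (F n) div N" for n
  \<comment> \<open>From \<open>m\<close> on, the parts of \<open>F n\<close> are nonempty.\<close>
  obtain m where m: "\<And>n. n \<ge> m \<Longrightarrow> N \<le> card (F n)"
    using lim by (auto simp: filterlim_at_top eventually_sequentially)
  have "\<forall>n. \<exists>P :: nat \<Rightarrow> 'a set.
          (\<forall>j<N. P j \<subseteq> F n \<and> card (P j) = r n) \<and> disjoint_family_on P {..<N}"
  proof
    fix n
    have le: "N * r n \<le> card (F n)"
      by (simp add: r_def)
    have fin: "finite (F n)"
      using F(1) by blast
    show "\<exists>P :: nat \<Rightarrow> 'a set. (\<forall>j<N. P j \<subseteq> F n \<and> card (P j) = r n) \<and> disjoint_family_on P {..<N}"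
      using disjoint_subsets_of_card[OF fin le] by metis
  qed
  then obtain P where P: "\<And>n j. j < N \<Longrightarrow> P n j \<subseteq> F n \<and> card (P n j) = r n"
      "\<And>n. disjoint_family_on (P n) {..<N}"
    by metis
  define S where "S j = (\<Union>n\<in>{m..}. P n j)" for j
  have SD: "S j \<subseteq> D" if "j < N" for j
    using P(1)[OF that] F(1) by (fastforce simp: S_def)
  have "disjoint_family_on S {..<N}"
    unfolding disjoint_family_on_def
  proof (intro ballI impI)
    fix i j assume ij: "i \<in> {..<N}" "j \<in> {..<N}" "i \<noteq> j"
    have "P n i \<inter> P n' j = {}" for n n'
    proof (cases "n = n'")
      case True
      then show ?thesis
        using P(2)[of n] ij by (auto simp: disjoint_family_on_def)
    next
      case False
      then show ?thesis
        using P(1) F(2)[OF False] ij by (meson disjoint_iff lessThan_iff subsetD)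
    qed
    then show "S i \<inter> S j = {}"
      by (auto simp: S_def)
  qed
  then have "disjoint_family_on (\<lambda>j. X closure_of S j) {..<N}"
    using Cstar_embedded_discrete_disjoint_closures[OF D] SD
    by (simp add: disjoint_family_on_def)
  then obtain j where j: "j < N" "K \<inter> X closure_of S j = {}"
    using finite_misses_disjoint_family[OF K(1)] by (metis N_def lessI)
  obtain h where h: "continuous_map X euclideanreal h" "\<And>x. x \<in> K \<Longrightarrow> h x = 0"
      "\<And>x. x \<in> X closure_of S j \<Longrightarrow> h x = 1"
    using completely_regular_space_finite_closed_sep[OF cr K closedin_closure_of j(2)] by metis
  have "S j \<subseteq> X closure_of S j"
    using SD[OF j(1)] DX by (intro closure_of_subset) auto
  with h(3) have h1: "\<And>x. x \<in> S j \<Longrightarrow> h x = 1"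
    by blast
  have r_pos: "0 < r n" if "n \<ge> m" for n
    using m[OF that] by (simp add: r_def N_def div_greater_zero_iff)
  \<comment> \<open>The remainder is below \<open>N \<le> N * r n\<close>, so it at most doubles the
    count. This bounds, uniformly in \<open>n\<close>, the cost of using only one part.\<close>
  have ratio: "real (card (F n)) \<le> 2 * N * r n" if "n \<ge> m" for n
  proof -
    have "card (F n) = N * r n + card (F n) mod N"
      by (simp add: r_def)
    moreover have "card (F n) mod N \<le> N * r n"
    proof -
      have "card (F n) mod N < N"
        by (simp add: N_def)
      also have "N \<le> N * r n"
        using r_pos[OF that] by simp
      finally show ?thesis by simp
    qed
    ultimately have "card (F n) \<le> 2 * N * r n"
      by linarith
    then show ?thesis
      by (metis of_nat_le_iff of_nat_mult of_nat_numeral)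
  qed
  define idx where "idx x = (THE n. x \<in> F n)" for x
  have idx: "idx x = n" if "x \<in> F n" for x n
    unfolding idx_def using that F(2) by (intro the_equality) blast+
  have "\<exists>f. continuous_map X euclideanreal f \<and> (\<forall>x\<in>K. f x = 0) \<and> averages F f = y"
    if y: "bdd_above (range (\<lambda>n. \<bar>y n\<bar>))" "\<forall>n<m. y n = 0" for y :: "nat \<Rightarrow> real"
  proof -
    obtain B where B: "\<And>n. \<bar>y n\<bar> \<le> B"
      using y(1) by (auto simp: bdd_above_def)
    have B0: "0 \<le> B"
      using B[of 0] by linarith
    \<comment> \<open>The constant which, placed on the \<open>r n\<close> points of the chosen
      part, makes the average over \<open>F n\<close> equal to \<open>y n\<close>.\<close>
    define c where "c n = y n * card (F n) / r n" for n
    have c_bound: "\<bar>c n\<bar> \<le> B * (2 * N)" if "n \<ge> m" for n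
    proof -
      have "real (card (F n)) / r n \<le> 2 * N"
        using ratio[OF that] r_pos[OF that] by (simp add: field_simps)
      then have "\<bar>y n\<bar> * (real (card (F n)) / r n) \<le> B * (2 * N)"
        using B B0 by (intro mult_mono) auto
      then show ?thesis
        by (simp add: c_def abs_mult)
    qed
    define \<phi> where "\<phi> x = (if x \<in> S j then c (idx x) else 0)" for x
    have "\<bar>\<phi> x\<bar> \<le> B * (2 * N)" for x
    proof (cases "x \<in> S j")
      case True
      then obtain n where "n \<ge> m" "x \<in> P n j"
        by (auto simp: S_def)
      moreover from this have "idx x = n"
        using P(1)[OF j(1)] idx by blast
      ultimately show ?thesis
        using c_bound True by (simp add: \<phi>_def)
    qed (use B0 in \<open>simp add: \<phi>_def\<close>)
    then have "bounded (\<phi> ` D)"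
      by (intro boundedI[where B = "B * (2 * N)"]) auto
    then obtain g where g: "continuous_map X euclideanreal g" "\<And>x. x \<in> D \<Longrightarrow> g x = \<phi> x"
      using Cstar_embedded_discrete_extension[OF D] by metis
    \<comment> \<open>On \<open>D\<close> the factor \<open>h\<close> is harmless: it is 1 on
      \<open>S j\<close>, and \<open>g\<close> is 0 elsewhere. Hence the product keeps the averages
      while vanishing on \<open>K\<close>.\<close>
    have val: "g x * h x = \<phi> x" if "x \<in> D" for x
      using g(2)[OF that] h1[of x] by (simp add: \<phi>_def)
    have "averages F (\<lambda>x. g x * h x) n = y n" for n
    proof -
      have Fn: "finite (F n)" "F n \<noteq> {}" "F n \<subseteq> D"
        using F(1) by blast+
      have "(\<Sum>x\<in>F n. g x * h x) = (\<Sum>x\<in>F n. \<phi> x)"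
        using val Fn(3) by (intro sum.cong) auto
      also have "\<dots> = y n * card (F n)"
      proof (cases "n \<ge> m")
        case True
        have iff: "x \<in> S j \<longleftrightarrow> x \<in> P n j" if "x \<in> F n" for x
        proof
          assume "x \<in> S j"
          then obtain n' where "x \<in> P n' j"
            by (auto simp: S_def)
          moreover from this have "n' = n"
            using P(1)[OF j(1)] idx that by blast
          ultimately show "x \<in> P n j"
            by simp
        qed (use True in \<open>auto simp: S_def\<close>)
        have "(\<Sum>x\<in>F n. \<phi> x) = (\<Sum>x\<in>F n. if x \<in> P n j then c n else 0)"
          using iff idx by (intro sum.cong) (auto simp: \<phi>_def)
        also have "\<dots> = (\<Sum>x\<in>P n j. c n)"
          using P(1)[OF j(1), of n] Fn(1) by (simp add: sum.inter_restrict[symmetric] Int_absorb1)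
        also have "\<dots> = y n * card (F n)"
          using P(1)[OF j(1), of n] r_pos[OF True] by (simp add: c_def)
        finally show ?thesis .
      next
        case False
        have "\<phi> x = 0" if "x \<in> F n" for x
        proof -
          have "x \<notin> S j"
          proof
            assume "x \<in> S j"
            then obtain n' where "n' \<ge> m" "x \<in> P n' j"
              by (auto simp: S_def)
            then have "n' = n"
              using P(1)[OF j(1)] idx that by blast
            with \<open>n' \<ge> m\<close> False show False by simp
          qed
          then show ?thesis
            by (simp add: \<phi>_def)
        qed
        then show ?thesis
          using y(2) False by simp
      qed
      finally show ?thesis
        using Fn by (simp add: averages_def)
    qed
    moreover have "continuous_map X euclideanreal (\<lambda>x. g x * h x)"
      using g(1) h(1) by (rule continuous_map_real_mult)
    ultimately show ?thesis
      using h(2) by (intro exI[of _ "\<lambda>x. g x * h x"]) auto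
  qed
  then show ?thesis
    by blast
qed


section \<open>The averaging map as a linear quotient map\<close>

lemma Cp_simps:
  "tvs_top (Cp X) = subtopology (powertop_real (topspace X)) {f. continuous_map X euclideanreal f}"
  "tvs_add (Cp X) = (\<lambda>f g. \<lambda>i\<in>topspace X. f i + g i)"
  "tvs_scale (Cp X) = (\<lambda>c f. \<lambda>i\<in>topspace X. c * f i)"
  "tvs_zero (Cp X) = (\<lambda>i\<in>topspace X. 0)"
  by (auto simp: Cp_def function_tvs_def)

lemma linf_pointwise_simps:
  "tvs_top linf_pointwise = subtopology (powertop_real UNIV) {x. bdd_above (range (\<lambda>n. \<bar>x n\<bar>))}"
  "tvs_add linf_pointwise = (\<lambda>f g i. f i + g i)"
  "tvs_scale linf_pointwise = (\<lambda>c f i. c * f i)"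
  "tvs_zero linf_pointwise = (\<lambda>i. 0)"
  by (auto simp: linf_pointwise_def function_tvs_def fun_eq_iff)

lemma continuous_map_Cp_eval: "i \<in> topspace X \<Longrightarrow> continuous_map (tvs_top (Cp X)) euclideanreal (\<lambda>f. f i)"
  unfolding Cp_simps by (intro continuous_map_from_subtopology continuous_map_product_coordinates)

lemma continuous_map_linf_eval: "continuous_map (tvs_top linf_pointwise) euclideanreal (\<lambda>f. f i)"
  unfolding linf_pointwise_simps
  by (intro continuous_map_from_subtopology continuous_map_product_coordinates) simp

lemma restrict_in_Cp:
  "continuous_map X euclideanreal f \<Longrightarrow> (\<lambda>i\<in>topspace X. f i) \<in> tvs_carrier (Cp X)"
  by (auto simp: tvs_carrier_Cp restrict_continuous_map)

text \<open>A basic box of the product topology constrains only the finitely many coordinates whose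
  factor is not the whole line; these form \<open>K\<close>.\<close>

lemma openin_Cp_box:
  assumes "openin (tvs_top (Cp X)) U" "f \<in> U"
  obtains K V where "finite K" "K \<subseteq> topspace X" "\<And>i. i \<in> K \<Longrightarrow> openin euclideanreal (V i) \<and> f i \<in> V i"
    "\<And>g. g \<in> tvs_carrier (Cp X) \<Longrightarrow> (\<And>i. i \<in> K \<Longrightarrow> g i \<in> V i) \<Longrightarrow> g \<in> U"
proof -
  obtain W where W: "openin (powertop_real (topspace X)) W" "U = W \<inter> {f. continuous_map X euclideanreal f}"
    using assms(1) by (auto simp: Cp_simps openin_subtopology)
  then have "f \<in> W"
    using assms(2) by simp
  with W(1) obtain V where V: "finite {i \<in> topspace X. V i \<noteq> topspace euclideanreal}"
     "\<And>i. i \<in> topspace X \<Longrightarrow> openin euclideanreal (V i)" "f \<in> Pi\<^sub>E (topspace X) V" "Pi\<^sub>E (topspace X) V \<subseteq> W"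
    unfolding openin_product_topology_alt by meson
  show thesis
  proof
    show "finite {i \<in> topspace X. V i \<noteq> topspace euclideanreal}"
      by (rule V)
    show "{i \<in> topspace X. V i \<noteq> topspace euclideanreal} \<subseteq> topspace X"
      by blast
    show "openin euclideanreal (V i) \<and> f i \<in> V i" if "i \<in> {i \<in> topspace X. V i \<noteq> topspace euclideanreal}" for i
      using V(2,3) that by (auto simp: PiE_iff)
    show "g \<in> U" if g: "g \<in> tvs_carrier (Cp X)"
      "\<And>i. i \<in> {i \<in> topspace X. V i \<noteq> topspace euclideanreal} \<Longrightarrow> g i \<in> V i" for g
    proof -
      have "g i \<in> V i" if "i \<in> topspace X" for i
        using g(2)[of i] that by (cases "V i = UNIV") auto
      then have "g \<in> Pi\<^sub>E (topspace X) V"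
        using g(1) by (simp add: PiE_iff tvs_carrier_Cp)
      then show ?thesis
        using V(4) W(2) g(1) by (auto simp: tvs_carrier_Cp)
    qed
  qed
qed

text \<open>The context is interpreted twice in the end: for one constructed sequence and for an
  arbitrary one.\<close>

locale averaging =
  fixes X :: "'a topology" and D :: "'a set" and F :: "nat \<Rightarrow> 'a set"
  assumes pseudocompact: "pseudocompact_space X"
    and discrete: "subtopology X D = discrete_topology D"
    and Cstar: "Cstar_embedded X D"
    and F: "\<And>n. F n \<noteq> {} \<and> finite (F n) \<and> F n \<subseteq> D"
    and F_disjoint: "\<And>m n. m \<noteq> n \<Longrightarrow> F m \<inter> F n = {}"
    and card_F: "filterlim (\<lambda>n. card (F n)) at_top sequentially"
begin

lemma F_subset: "F n \<subseteq> topspace X"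
  using F Cstar by (auto simp: Cstar_embedded_def)

text \<open>Allows passing freely between functions on the whole type and their extensional
  representatives in \<open>Cp X\<close>.\<close>

lemma averages_restrict: "averages F (\<lambda>i\<in>topspace X. f i) = averages F f"
  using F_subset by (intro averages_cong) auto

lemma averages_tvs_add:
  "averages F (tvs_add (Cp X) f g) = tvs_add linf_pointwise (averages F f) (averages F g)"
  by (simp add: Cp_simps linf_pointwise_simps averages_restrict averages_add)

lemma averages_tvs_scale:
  "averages F (tvs_scale (Cp X) c f) = tvs_scale linf_pointwise c (averages F f)"
  by (simp add: Cp_simps linf_pointwise_simps averages_restrict averages_scale)

text \<open>Pseudocompactness enters here: it makes \<open>f\<close>, and with it the averages,
  bounded.\<close>

lemma averages_in_linf: "f \<in> tvs_carrier (Cp X) \<Longrightarrow> averages F f \<in> tvs_carrier linf_pointwise"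
  using pseudocompact averages_bounded[of f "topspace X" F] F_subset
  by (auto simp: tvs_carrier_Cp tvs_carrier_linf_pointwise pseudocompact_space_def)

text \<open>Extend the function that is constantly \<open>y n\<close> on each
  \<open>F n\<close>.\<close>

lemma averages_surj:
  assumes "y \<in> tvs_carrier linf_pointwise"
  obtains f where "f \<in> tvs_carrier (Cp X)" "averages F f = y"
proof -
  have bdd: "bdd_above (range (\<lambda>n. \<bar>y n\<bar>))"
    using assms by (simp add: tvs_carrier_linf_pointwise)
  obtain B where B: "\<And>n. \<bar>y n\<bar> \<le> B"
    using bdd by (auto simp: bdd_above_def)
  have idx: "(THE n. x \<in> F n) = n" if "x \<in> F n" for x n
    using that F_disjoint by (intro the_equality) blast+
  \<comment> \<open>For \<open>x\<close> in no \<open>F n\<close> the index is unspecified, but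
    \<open>y\<close> is still bounded by \<open>B\<close> there.\<close>
  have "bounded ((\<lambda>x. y (THE n. x \<in> F n)) ` D)"
    using B by (intro boundedI[where B = B]) auto
  then obtain g where g: "continuous_map X euclideanreal g" "\<And>x. x \<in> D \<Longrightarrow> g x = y (THE n. x \<in> F n)"
    using Cstar_embedded_discrete_extension[OF Cstar discrete] by metis
  have "averages F g n = y n" for n
  proof -
    have "(\<Sum>x\<in>F n. g x) = (\<Sum>x\<in>F n. y n)"
      using g(2) F[of n] idx by (intro sum.cong) auto
    then show ?thesis
      using F[of n] by (simp add: averages_def)
  qed
  then show thesis
    using that[of "\<lambda>i\<in>topspace X. g i"] g(1) restrict_in_Cp averages_restrict by auto
qed

lemma continuous_averages: "continuous_map (tvs_top (Cp X)) (tvs_top linf_pointwise) (averages F)"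
proof -
  have "continuous_map (tvs_top (Cp X)) euclideanreal (\<lambda>f. averages F f n)" for n
  proof -
    have "continuous_map (tvs_top (Cp X)) euclideanreal (\<lambda>f. \<Sum>x\<in>F n. f x)"
      using F[of n] F_subset[of n] by (intro continuous_map_sum continuous_map_Cp_eval) auto
    then show ?thesis
      unfolding averages_def divide_inverse by (rule continuous_map_real_mult_right)
  qed
  then have "continuous_map (tvs_top (Cp X)) (powertop_real UNIV) (averages F)"
    by (simp add: continuous_map_componentwise_UNIV)
  then show ?thesis
    using averages_in_linf
    by (auto simp: linf_pointwise_simps(1) continuous_map_in_subtopology tvs_carrier_linf_pointwise)
qed

text \<open>For \<open>y\<close> near \<open>y0\<close> a preimage of \<open>y\<close> is built that
  stays in the box around \<open>f0\<close>. Nearness is needed only in the coordinates below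
  \<open>m\<close>; the tail of \<open>y - y0\<close> may be any bounded sequence.\<close>

lemma open_map_averages: "open_map (tvs_top (Cp X)) (tvs_top linf_pointwise) (averages F)"
  unfolding open_map_def
proof (intro allI impI)
  fix U assume U: "openin (tvs_top (Cp X)) U"
  show "openin (tvs_top linf_pointwise) (averages F ` U)"
  proof (subst openin_subopen, intro ballI)
    fix y0 assume "y0 \<in> averages F ` U"
    then obtain f0 where f0: "f0 \<in> U" "y0 = averages F f0"
      by blast
    have f0C: "f0 \<in> tvs_carrier (Cp X)"
      using U f0(1) openin_subset by blast
    then have f0c: "continuous_map X euclideanreal f0"
      by (simp add: tvs_carrier_Cp)
    obtain K V where K: "finite K" "K \<subseteq> topspace X" and V: "\<And>i. i \<in> K \<Longrightarrow> openin euclideanreal (V i) \<and> f0 i \<in> V i"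
      and sub: "\<And>g. g \<in> tvs_carrier (Cp X) \<Longrightarrow> (\<And>i. i \<in> K \<Longrightarrow> g i \<in> V i) \<Longrightarrow> g \<in> U"
      using openin_Cp_box[OF U f0(1)] by metis
    have "completely_regular_space X"
      using pseudocompact by (simp add: pseudocompact_space_def tychonoff_space_def)
    then obtain m where m: "\<And>y. bdd_above (range (\<lambda>n. \<bar>y n\<bar>)) \<Longrightarrow> (\<And>n. n < m \<Longrightarrow> y n = 0) \<Longrightarrow>
           \<exists>f. continuous_map X euclideanreal f \<and> (\<forall>x\<in>K. f x = 0) \<and> averages F f = y"
      using averages_preimage_vanishing_on_finite[OF _ Cstar discrete F F_disjoint card_F K] by metis
    have "\<exists>e. continuous_map X euclideanreal e \<and> averages F e = (\<lambda>k. if k = n then 1 else 0)" for n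
    proof -
      have "(\<lambda>k. if k = n then 1 else 0) \<in> tvs_carrier linf_pointwise"
        by (auto simp: tvs_carrier_linf_pointwise bdd_above_def intro!: exI[of _ 1])
      then obtain e where "e \<in> tvs_carrier (Cp X)" "averages F e = (\<lambda>k. if k = n then 1 else 0)"
        by (rule averages_surj)
      then show ?thesis
        by (auto simp: tvs_carrier_Cp)
    qed
    then obtain e where e: "\<And>n. continuous_map X euclideanreal (e n)"
        "\<And>n. averages F (e n) = (\<lambda>k. if k = n then 1 else 0)"
      by metis
    \<comment> \<open>The coordinates below \<open>m\<close> are corrected by fixed functions \<open>e n\<close>, the remaining ones
      by a function that vanishes on \<open>K\<close>.\<close>
    define \<psi> where "\<psi> y i = f0 i + (\<Sum>n<m. (y n - y0 n) * e n i)" for y :: "nat \<Rightarrow> real" and i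
    \<comment> \<open>At \<open>y0\<close> all corrections vanish, so \<open>\<psi> y0\<close> is
      \<open>f0\<close>. For each point \<open>i\<close>, \<open>\<psi> y i\<close> is continuous in
      \<open>y\<close>, which makes \<open>W\<close> an open neighbourhood of
      \<open>y0\<close>.\<close>
    define W where "W = topspace (tvs_top linf_pointwise) \<inter>
        (\<Inter>i\<in>K. {y \<in> topspace (tvs_top linf_pointwise). \<psi> y i \<in> V i})"
    have "openin (tvs_top linf_pointwise) {y \<in> topspace (tvs_top linf_pointwise). \<psi> y i \<in> V i}"
      if "i \<in> K" for i
    proof (rule openin_continuous_map_preimage)
      show "continuous_map (tvs_top linf_pointwise) euclideanreal (\<lambda>y. \<psi> y i)"
        unfolding \<psi>_def
        by (intro continuous_map_add continuous_map_sum continuous_map_real_mult continuous_map_diff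
            continuous_map_linf_eval) auto
    qed (use V that in blast)
    then have "openin (tvs_top linf_pointwise) W"
      unfolding W_def using K(1) by (intro openin_Int_Inter) auto
    moreover have "y0 \<in> W"
      using averages_in_linf[OF f0C] V by (auto simp: W_def \<psi>_def f0(2))
    moreover have "W \<subseteq> averages F ` U"
    proof
      fix y assume y: "y \<in> W"
      have bdd: "bdd_above (range (\<lambda>n. \<bar>y n\<bar>))" "bdd_above (range (\<lambda>n. \<bar>y0 n\<bar>))"
        using y averages_in_linf[OF f0C] f0(2) by (auto simp: W_def tvs_carrier_linf_pointwise)
      define z where "z n = (if n < m then 0 else y n - y0 n)" for n
      obtain B B' where "\<And>n. \<bar>y n\<bar> \<le> B" "\<And>n. \<bar>y0 n\<bar> \<le> B'"
        using bdd by (auto simp: bdd_above_def)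
      then have "\<bar>z n\<bar> \<le> B + B'" for n
        by (smt (verit, best) z_def)
      then have "bdd_above (range (\<lambda>n. \<bar>z n\<bar>))"
        by (auto simp: bdd_above_def)
      then obtain f where f: "continuous_map X euclideanreal f" "\<And>x. x \<in> K \<Longrightarrow> f x = 0" "averages F f = z"
        using m[of z] by (auto simp: z_def)
      \<comment> \<open>On \<open>K\<close> the tail correction \<open>f\<close> vanishes, so
        \<open>g\<close> meets the box conditions because \<open>\<psi> y\<close> does.\<close>
      define g where "g = (\<lambda>i\<in>topspace X. \<psi> y i + f i)"
      have \<psi>c: "continuous_map X euclideanreal (\<psi> y)"
        unfolding \<psi>_def using e(1)
        by (intro continuous_map_add continuous_map_sum continuous_map_real_mult f0c) auto
      have "g \<in> tvs_carrier (Cp X)"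
        unfolding g_def by (intro restrict_in_Cp continuous_map_add \<psi>c f(1))
      moreover have "g i \<in> V i" if "i \<in> K" for i
        using that K(2) y f(2)[OF that] by (auto simp: g_def W_def)
      ultimately have "g \<in> U"
        using sub by blast
      moreover have "averages F g n = y n" for n
      proof -
        have "averages F g n = averages F f0 n + (\<Sum>k<m. (y k - y0 k) * averages F (e k) n) + z n"
          by (simp add: g_def averages_restrict averages_add \<psi>_def f(3) averages_sum averages_scale)
        also have "(\<Sum>k<m. (y k - y0 k) * averages F (e k) n) = (if n < m then y n - y0 n else 0)"
          by (simp add: e(2) if_distrib[of "(*) _"] cong: if_cong)
        finally show ?thesis
          by (auto simp: z_def f0(2))
      qed
      ultimately show "y \<in> averages F ` U"
        by (metis ext image_eqI)
    qed
    ultimately show "\<exists>T. openin (tvs_top linf_pointwise) T \<and> y0 \<in> T \<and> T \<subseteq> averages F ` U"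
      by blast
  qed
qed

section \<open>The kernel and the induced isomorphism\<close>

definition null_space :: "('a \<Rightarrow> real) set" where
  "null_space = (\<Inter>n. {f \<in> tvs_carrier (Cp X). (\<Sum>x\<in>F n. f x) = 0})"

lemma null_space_eq: "null_space = {f \<in> tvs_carrier (Cp X). averages F f = (\<lambda>n. 0)}"
  using F by (auto simp: null_space_def averages_def fun_eq_iff)

lemma closed_null_space: "tvs_closed_subspace (Cp X) null_space"
proof -
  have "closedin (tvs_top (Cp X)) {f \<in> tvs_carrier (Cp X). (\<Sum>x\<in>F n. f x) \<in> {0}}" for n
    using F[of n] F_subset[of n]
    by (intro closedin_continuous_map_preimage[of _ euclideanreal] continuous_map_sum
        continuous_map_Cp_eval) auto
  then have "closedin (tvs_top (Cp X)) null_space"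
    unfolding null_space_def by (intro closedin_Inter) auto
  moreover have "averages F (tvs_zero (Cp X)) = (\<lambda>n. 0)"
    unfolding Cp_simps averages_restrict by (simp add: averages_def fun_eq_iff)
  then have "tvs_subspace (Cp X) null_space"
    using tvs_subspace_Cp[of X]
    by (auto simp: tvs_subspace_def null_space_eq averages_tvs_add averages_tvs_scale linf_pointwise_simps)
  ultimately show ?thesis
    by (simp add: tvs_closed_subspace_def)
qed

text \<open>The left-to-right direction makes the averages well defined on cosets; the converse
  makes the induced map injective.\<close>

lemma coset_eq_iff:
  assumes "f \<in> tvs_carrier (Cp X)" "g \<in> tvs_carrier (Cp X)"
  shows "tvs_coset (Cp X) null_space f = tvs_coset (Cp X) null_space g \<longleftrightarrow> averages F f = averages F g"
proof
  assume "tvs_coset (Cp X) null_space f = tvs_coset (Cp X) null_space g"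
  moreover have "tvs_zero (Cp X) \<in> null_space"
    using closed_null_space by (auto simp: tvs_closed_subspace_def tvs_subspace_def)
  moreover have "tvs_add (Cp X) f (tvs_zero (Cp X)) = f"
    using assms by (auto simp: Cp_simps tvs_carrier_Cp fun_eq_iff extensional_def)
  ultimately obtain z where "z \<in> null_space" "f = tvs_add (Cp X) g z"
    unfolding tvs_coset_def by (metis (no_types, lifting) imageE image_eqI)
  then show "averages F f = averages F g"
    by (simp add: averages_tvs_add null_space_eq linf_pointwise_simps)
next
  have sub: "tvs_coset (Cp X) null_space f \<subseteq> tvs_coset (Cp X) null_space g"
    if f: "f \<in> tvs_carrier (Cp X)" and g: "g \<in> tvs_carrier (Cp X)"
      and eq: "averages F f = averages F g" for f g
  proof
    fix h assume "h \<in> tvs_coset (Cp X) null_space f"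
    then obtain z where z: "z \<in> null_space" "h = tvs_add (Cp X) f z"
      by (auto simp: tvs_coset_def)
    \<comment> \<open>This is \<open>h - g\<close>, which lies in the kernel and exhibits
      \<open>h\<close> as an element of the coset of \<open>g\<close>.\<close>
    define w where "w = tvs_add (Cp X) (tvs_add (Cp X) f z) (tvs_scale (Cp X) (-1) g)"
    have "w \<in> tvs_carrier (Cp X)"
      using tvs_subspace_Cp[of X] f g z(1) by (auto simp: tvs_subspace_def w_def null_space_eq)
    moreover have "averages F w = (\<lambda>n. 0)"
      using z(1) eq by (simp add: w_def averages_tvs_add averages_tvs_scale null_space_eq linf_pointwise_simps)
    ultimately have "w \<in> null_space"
      by (simp add: null_space_eq)
    moreover have "h = tvs_add (Cp X) g w"
      by (auto simp: w_def z(2) Cp_simps fun_eq_iff)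
    ultimately show "h \<in> tvs_coset (Cp X) null_space g"
      by (auto simp: tvs_coset_def)
  qed
  assume "averages F f = averages F g"
  then show "tvs_coset (Cp X) null_space f = tvs_coset (Cp X) null_space g"
    using sub assms by (metis subset_antisym)
qed

text \<open>The averaging map is a continuous open surjection, hence a quotient map. The map
  \<open>T\<close> it induces on cosets is then an injective quotient map, that is, a
  homeomorphism.\<close>

lemma quotient_isomorphic_linf: "tvs_isomorphic (tvs_quotient (Cp X) null_space) linf_pointwise"
proof -
  let ?q = "tvs_coset (Cp X) null_space" and ?Q = "tvs_quotient (Cp X) null_space"
  have top: "tvs_top ?Q = quotient_topology (tvs_top (Cp X)) ?q"
    by (simp add: tvs_quotient_def)
  have carrier: "tvs_carrier ?Q = ?q ` tvs_carrier (Cp X)"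
    by (simp add: top)
  have q: "quotient_map (tvs_top (Cp X)) (tvs_top ?Q) ?q"
    by (simp add: top quotient_map_quotient_topology)
  have surj: "averages F ` tvs_carrier (Cp X) = tvs_carrier linf_pointwise"
    using averages_in_linf averages_surj by (metis image_subsetI rev_image_eqI subsetI subset_antisym)
  obtain T where T: "continuous_map (tvs_top ?Q) (tvs_top linf_pointwise) T"
      "\<And>f. f \<in> tvs_carrier (Cp X) \<Longrightarrow> T (?q f) = averages F f"
    using quotient_map_lift_exists[OF q continuous_averages] coset_eq_iff by metis
  have "quotient_map (tvs_top (Cp X)) (tvs_top linf_pointwise) (averages F)"
    using continuous_open_imp_quotient_map continuous_averages open_map_averages surj by blast
  then have "quotient_map (tvs_top (Cp X)) (tvs_top linf_pointwise) (T \<circ> ?q)"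
    by (rule quotient_map_eq) (simp add: T(2))
  then have "quotient_map (tvs_top ?Q) (tvs_top linf_pointwise) T"
    using quotient_map_from_composition quotient_imp_continuous_map[OF q] T(1) by blast
  moreover have "inj_on T (tvs_carrier ?Q)"
    using T(2) coset_eq_iff by (auto simp: carrier inj_on_def)
  ultimately have "homeomorphic_map (tvs_top ?Q) (tvs_top linf_pointwise) T"
    by (simp add: homeomorphic_map_def)
  moreover have sub: "tvs_subspace (Cp X) null_space"
    using closed_null_space by (simp add: tvs_closed_subspace_def)
  have closed: "tvs_add (Cp X) f g \<in> tvs_carrier (Cp X)" "tvs_scale (Cp X) c f \<in> tvs_carrier (Cp X)"
    if "f \<in> tvs_carrier (Cp X)" "g \<in> tvs_carrier (Cp X)" for f g c
    using tvs_subspace_Cp[of X] that by (auto simp: tvs_subspace_def)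
  have "T (tvs_add ?Q a b) = tvs_add linf_pointwise (T a) (T b)"
    if "a \<in> tvs_carrier ?Q" "b \<in> tvs_carrier ?Q" for a b
    using that closed by (auto simp: carrier tvs_quotient_Cp_add[OF sub] T(2) averages_tvs_add)
  moreover have "T (tvs_scale ?Q c a) = tvs_scale linf_pointwise c (T a)"
    if "a \<in> tvs_carrier ?Q" for a c
    using that closed by (auto simp: carrier tvs_quotient_Cp_scale[OF sub] T(2) averages_tvs_scale)
  ultimately show ?thesis
    unfolding tvs_isomorphic_def by blast
qed

end


section \<open>Metrizability and dimension\<close>

lemma metrizable_linf_pointwise: "metrizable_space (tvs_top linf_pointwise)"
  unfolding linf_pointwise_simps
  by (intro metrizable_space_subtopology) (simp add: metrizable_space_product_topology metrizable_space_euclidean)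

text \<open>Supplies the two algebraic facts about the quotient that the dimension argument
  assumes.\<close>

lemma tvs_quotient_Cp_subspace:
  assumes "tvs_subspace (Cp X) Z"
  shows "tvs_subspace (tvs_quotient (Cp X) Z) (tvs_carrier (tvs_quotient (Cp X) Z))"
    and "tvs_scale (tvs_quotient (Cp X) Z) 0 (tvs_zero (tvs_quotient (Cp X) Z)) =
      tvs_zero (tvs_quotient (Cp X) Z)"
proof -
  have carrier: "tvs_carrier (tvs_quotient (Cp X) Z) = tvs_coset (Cp X) Z ` tvs_carrier (Cp X)"
    by (simp add: tvs_quotient_def)
  show "tvs_subspace (tvs_quotient (Cp X) Z) (tvs_carrier (tvs_quotient (Cp X) Z))"
    using tvs_subspace_Cp[of X]
    by (auto simp: tvs_subspace_def carrier tvs_quotient_Cp_zero[OF assms]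
        tvs_quotient_Cp_add[OF assms] tvs_quotient_Cp_scale[OF assms])
  have "tvs_scale (Cp X) 0 (tvs_zero (Cp X)) = tvs_zero (Cp X)"
    by (auto simp: Cp_simps)
  then show "tvs_scale (tvs_quotient (Cp X) Z) 0 (tvs_zero (tvs_quotient (Cp X) Z)) =
      tvs_zero (tvs_quotient (Cp X) Z)"
    by (simp add: tvs_quotient_Cp_zero[OF assms] tvs_quotient_Cp_scale[OF assms])
qed

interpretation sequences: vector_space "\<lambda>c (x :: nat \<Rightarrow> real) n. c * x n"
  by unfold_locales (auto simp: fun_eq_iff algebra_simps)

text \<open>A finite spanning set of \<open>E\<close> would be mapped to a finite set whose span
  contains all bounded sequences, among them infinitely many independent unit sequences.\<close>

lemma isomorphic_linf_infinite_dimensional: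
  assumes iso: "tvs_isomorphic E linf_pointwise"
    and E: "tvs_subspace E (tvs_carrier E)" "tvs_scale E 0 (tvs_zero E) = tvs_zero E"
  shows "tvs_infinite_dimensional E"
  unfolding tvs_infinite_dimensional_def
proof
  assume "\<exists>B. finite B \<and> B \<subseteq> tvs_carrier E \<and> tvs_subspace E hull B = tvs_carrier E"
  then obtain B where B: "finite B" "B \<subseteq> tvs_carrier E" "tvs_subspace E hull B = tvs_carrier E"
    by blast
  obtain T where T: "homeomorphic_map (tvs_top E) (tvs_top linf_pointwise) T"
     "\<And>x y. x \<in> tvs_carrier E \<Longrightarrow> y \<in> tvs_carrier E \<Longrightarrow> T (tvs_add E x y) = T x + T y"
     "\<And>c x. x \<in> tvs_carrier E \<Longrightarrow> T (tvs_scale E c x) = (\<lambda>n. c * T x n)"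
    using iso by (auto simp: tvs_isomorphic_def linf_pointwise_simps plus_fun_def)
  have zero: "tvs_zero E \<in> tvs_carrier E"
    using E(1) by (simp add: tvs_subspace_def)
  have T0: "T (tvs_zero E) = 0"
    using T(3)[OF zero, of 0] E(2) by (simp add: zero_fun_def)
  \<comment> \<open>The preimage of the span is a subspace containing \<open>B\<close>, so it
    contains the hull of \<open>B\<close>.\<close>
  have "tvs_subspace E {x \<in> tvs_carrier E. T x \<in> sequences.span (T ` B)}"
    using E(1) T(2,3) T0 by (auto simp: tvs_subspace_def sequences.span_zero
        intro: sequences.span_add sequences.span_scale)
  then have "tvs_subspace E hull B \<subseteq> {x \<in> tvs_carrier E. T x \<in> sequences.span (T ` B)}"
    using B(2) by (intro hull_minimal) (auto intro: sequences.span_base)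
  then have "T ` tvs_carrier E \<subseteq> sequences.span (T ` B)"
    using B(3) by auto
  then have span: "tvs_carrier linf_pointwise \<subseteq> sequences.span (T ` B)"
    using homeomorphic_imp_surjective_map[OF T(1)] by simp
  define e :: "nat \<Rightarrow> nat \<Rightarrow> real" where "e n = (\<lambda>k. if k = n then 1 else 0)" for n
  have inj: "inj e"
    by (rule injI) (metis e_def zero_neq_one)
  have "sequences.independent (range e)"
  proof
    assume "sequences.dependent (range e)"
    then obtain n where n: "e n \<in> sequences.span (range e - {e n})"
      by (auto simp: sequences.dependent_def)
    \<comment> \<open>Vanishing at \<open>n\<close> is a linear condition satisfied by all the other
      unit sequences, but not by \<open>e n\<close>.\<close>
    have "sequences.span (range e - {e n}) \<subseteq> {x. x n = 0}"
    proof (rule sequences.span_minimal)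
      show "range e - {e n} \<subseteq> {x. x n = 0}"
        by (auto simp: e_def)
      show "sequences.subspace {x. x n = 0}"
        by (auto simp: sequences.subspace_def)
    qed
    with n have "e n n = 0"
      by blast
    then show False
      by (simp add: e_def)
  qed
  moreover have "range e \<subseteq> tvs_carrier linf_pointwise"
    by (auto simp: tvs_carrier_linf_pointwise e_def bdd_above_def intro!: exI[of _ 1])
  ultimately have "finite (range e)"
    using sequences.independent_span_bound[of "T ` B" "range e"] B(1) span by blast
  then show False
    using inj finite_imageD by blast
qed

text \<open>The pairing function arranges a sequence of distinct points of \<open>D\<close> in
  disjoint rows. \<open>F n\<close> takes the first \<open>n + 1\<close> entries of row
  \<open>n\<close>, so even \<open>F 0\<close> is nonempty.\<close>

lemma infinite_disjoint_finite_subsets: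
  assumes "infinite D"
  obtains F :: "nat \<Rightarrow> 'a set" where "\<And>n. F n \<noteq> {} \<and> finite (F n) \<and> F n \<subseteq> D"
    "\<And>m n. m \<noteq> n \<Longrightarrow> F m \<inter> F n = {}" "filterlim (\<lambda>n. card (F n)) at_top sequentially"
proof -
  obtain d :: "nat \<Rightarrow> 'a" where d: "inj d" "range d \<subseteq> D"
    using infinite_countable_subset[OF assms] by blast
  have d_eq: "d (prod_encode a) = d (prod_encode b) \<longleftrightarrow> a = b" for a b
    using d(1) by (simp add: inj_eq prod_encode_eq)
  define F where "F n = (\<lambda>i. d (prod_encode (n, i))) ` {..n}" for n
  have "card (F n) = Suc n" for n
    unfolding F_def by (subst card_image) (auto simp: inj_on_def d_eq)
  then have "filterlim (\<lambda>n. card (F n)) at_top sequentially"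
    by (simp add: filterlim_Suc)
  moreover have "F m \<inter> F n = {}" if "m \<noteq> n" for m n
    using that by (auto simp: F_def d_eq)
  moreover have "F n \<noteq> {} \<and> finite (F n) \<and> F n \<subseteq> D" for n
    using d(2) by (auto simp: F_def)
  ultimately show thesis
    using that by blast
qed

theorem theorem1:
  fixes X :: "'a topology" and D :: "'a set"
  assumes "tychonoff_space X"
    and "pseudocompact_space X"
    and "D \<subseteq> topspace X"
    and "infinite D"
    and "subtopology X D = discrete_topology D"
    and "Cstar_embedded X D"
  shows "(\<exists>Z. tvs_closed_subspace (Cp X) Z
              \<and> tvs_infinite_dimensional (tvs_quotient (Cp X) Z)
              \<and> metrizable_space (tvs_top (tvs_quotient (Cp X) Z)))
       \<and> (\<forall>F :: nat \<Rightarrow> 'a set.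
            (\<forall>n. F n \<noteq> {} \<and> finite (F n) \<and> F n \<subseteq> D)
            \<and> (\<forall>m n. m \<noteq> n \<longrightarrow> F m \<inter> F n = {})
            \<and> filterlim (\<lambda>n. card (F n)) at_top sequentially
            \<longrightarrow> (let Z = (\<Inter>n. {f \<in> tvs_carrier (Cp X). (\<Sum>x\<in>F n. f x) = 0})
                 in tvs_closed_subspace (Cp X) Z
                    \<and> tvs_isomorphic (tvs_quotient (Cp X) Z) linf_pointwise))"
proof
  \<comment> \<open>The existence claim follows from the isomorphism for a single admissible
    sequence, which the infinite set \<open>D\<close> provides.\<close>
  obtain F :: "nat \<Rightarrow> 'a set" where F: "\<And>n. F n \<noteq> {} \<and> finite (F n) \<and> F n \<subseteq> D"
      "\<And>m n. m \<noteq> n \<Longrightarrow> F m \<inter> F n = {}" "filterlim (\<lambda>n. card (F n)) at_top sequentially"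
    using infinite_disjoint_finite_subsets[OF assms(4)] by metis
  interpret averaging X D F
    by unfold_locales (use assms F in auto)
  have sub: "tvs_subspace (Cp X) null_space"
    using closed_null_space by (simp add: tvs_closed_subspace_def)
  have "tvs_infinite_dimensional (tvs_quotient (Cp X) null_space)"
    using isomorphic_linf_infinite_dimensional quotient_isomorphic_linf tvs_quotient_Cp_subspace[OF sub]
    by blast
  moreover have "tvs_top (tvs_quotient (Cp X) null_space) homeomorphic_space tvs_top linf_pointwise"
    using quotient_isomorphic_linf homeomorphic_map_imp_homeomorphic_space
    by (auto simp: tvs_isomorphic_def)
  then have "metrizable_space (tvs_top (tvs_quotient (Cp X) null_space))"
    using homeomorphic_metrizable_space metrizable_linf_pointwise by blast
  ultimately show "\<exists>Z. tvs_closed_subspace (Cp X) Z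
              \<and> tvs_infinite_dimensional (tvs_quotient (Cp X) Z)
              \<and> metrizable_space (tvs_top (tvs_quotient (Cp X) Z))"
    using closed_null_space by blast
next
  show "\<forall>F :: nat \<Rightarrow> 'a set.
            (\<forall>n. F n \<noteq> {} \<and> finite (F n) \<and> F n \<subseteq> D)
            \<and> (\<forall>m n. m \<noteq> n \<longrightarrow> F m \<inter> F n = {})
            \<and> filterlim (\<lambda>n. card (F n)) at_top sequentially
            \<longrightarrow> (let Z = (\<Inter>n. {f \<in> tvs_carrier (Cp X). (\<Sum>x\<in>F n. f x) = 0})
                 in tvs_closed_subspace (Cp X) Z
                    \<and> tvs_isomorphic (tvs_quotient (Cp X) Z) linf_pointwise)"
  proof (intro allI impI, elim conjE)
    fix F :: "nat \<Rightarrow> 'a set"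
    assume "\<forall>n. F n \<noteq> {} \<and> finite (F n) \<and> F n \<subseteq> D" "\<forall>m n. m \<noteq> n \<longrightarrow> F m \<inter> F n = {}"
      "filterlim (\<lambda>n. card (F n)) at_top sequentially"
    then interpret averaging X D F
      by unfold_locales (use assms in auto)
    show "let Z = (\<Inter>n. {f \<in> tvs_carrier (Cp X). (\<Sum>x\<in>F n. f x) = 0})
                 in tvs_closed_subspace (Cp X) Z
                    \<and> tvs_isomorphic (tvs_quotient (Cp X) Z) linf_pointwise"
      unfolding Let_def null_space_def[symmetric]
      using closed_null_space quotient_isomorphic_linf by blast
  qed
qed

end
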